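(* Let $\mathcal H$ be a real Hilbert space, $\mathcal B,\mathcal C$ Banach spaces, and $\iota_{\mathcal B}:\mathcal H\to\mathcal B$, $\iota_{\mathcal C}:\mathcal H\to\mathcal C$ compact linear embeddings. Let $\mathcal O\subset\mathcal H$ and $\mathcal U\subset\mathcal C$ be open with $\iota_{\mathcal C}(\mathcal O)\subset\mathcal U$, and let $\mathcal E\in C^1(\mathcal O)$ and $\mathcal F\in C^1(\mathcal U)$ be real-valued. Let $\mathcal M\subset\mathcal O$ be a $C^1$-submanifold of $\mathcal H$ without boundary such that $\mathcal E$ and $\mathcal F\circ\iota_{\mathcal C}$ are bounded from below on $\mathcal M$, and let $\mathrm{pr}^{\mathcal M}:\mathcal M\to L(\mathcal H)$ be a continuous map such that for each $x\in\mathcal M$ the operator $\mathrm{pr}^{\mathcal M}_x$ is a continuous linear projector onto $T_x\mathcal M$. Assume: (P) $\mathrm{pr}^{\mathcal M}$ is bounded on $\mathcal E$-controlled subsets of $\mathcal M$. (P* ) There is a map $\mathrm{Pr}:\mathcal M\to L(\mathcal C)$, bounded on $\mathcal E$-controlled subsets of $\mathcal M$, with $\iota_{\mathcal C}\,\mathrm{pr}^{\mathcal M}_x=\mathrm{Pr}_x\,\iota_{\mathcal C}$ for all $x\in\mathcal M$. (B* ) For every $K\in\mathbb R$ the sublevel set $\{x\in\mathcal M:\mathcal E(x)\le K\}$ is bounded in $\mathcal H$. (L* ) Whenever a sequence $(x_k)\subset\mathcal M$ converges weakly in $\mathcal H$ to some $x_\infty$ and $\sup_k\mathcal F(\iota_{\mathcal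 C}x_k)<\infty$, then $x_\infty\in\mathcal M$. (S) There are a function $\mu:\mathcal M\to(0,\infty)$, a continuous bilinear form $Q:\mathcal H\times\mathcal H\to\mathbb R$, and a map $R:\mathcal M\to\mathcal B^*$ such that $D\mathcal E_xh=\mu(x)Q(x,h)+R_x\,\iota_{\mathcal B}h$ for all $x\in\mathcal M$, $h\in\mathcal H$, where (S1) for every $\mathcal E$-controlled $V\subset\mathcal M$ there are $0<m\le M<\infty$ with $m\le\mu\le M$ on $V$; (S2) there is $c>0$ with $Q(h,h)\ge c\|h\|_{\mathcal H}^2$ for all $h\in\mathcal H$; (S3) $R$ is bounded on $\mathcal E$-controlled subsets of $\mathcal M$. (D) There is a map $S:\mathcal M\to\mathcal B^*$, bounded on $\mathcal E$-controlled subsets of $\mathcal M$, such that $D\mathcal E_x(\mathrm{Id}_{\mathcal H}-\mathrm{pr}^{\mathcal M}_x)h=S_x\,\iota_{\mathcal B}h$ for all $x\in\mathcal M$, $h\in\mathcal H$. Then for every $\theta>0$ the restriction $\widetilde{\mathcal T}=\mathcal T|_{\mathcal M}$ of the total energy $\mathcal T=\mathcal E+\theta\,(\mathcal F\circ\iota_{\mathcal C})$ satisfies the Palais–Smale condition.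
   Context: $L(X)$ denotes bounded linear operators on a normed space $X$ with operator norm; $T_x\mathcal M\subset\mathcal H$ carries the norm of $\mathcal H$. A subset $V\subset\mathcal M$ is called $\mathcal E$-controlled if $V$ is bounded in $\mathcal H$ and $\mathcal E$ is bounded on $V$. A map from $\mathcal M$ to a normed space is bounded on $V$ if the norms of its values on $V$ are bounded. A Palais–Smale sequence for a $C^1$ function $\widetilde{\mathcal T}$ on $\mathcal M$ is a sequence $(x_k)\subset\mathcal M$ with $\sup_k\widetilde{\mathcal T}(x_k)<\infty$ and $\|D\widetilde{\mathcal T}_{x_k}\|_{(T_{x_k}\mathcal M)^*}\to0$. $\widetilde{\mathcal T}$ satisfies the Palais–Smale condition if every Palais–Smale sequence has a subsequence converging to a point of $\mathcal M$. *)

theory Defs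
  imports "HOL-Analysis.Analysis"
begin

definition compact_embedding :: "('a::real_normed_vector \<Rightarrow> 'b::real_normed_vector) \<Rightarrow> bool"
  where "compact_embedding \<iota> \<longleftrightarrow>
    bounded_linear \<iota> \<and> inj \<iota> \<and> (\<forall>V. bounded V \<longrightarrow> compact (closure (\<iota> ` V)))"

definition C1_on :: "('a::real_normed_vector \<Rightarrow> 'b::real_normed_vector) \<Rightarrow> 'a set \<Rightarrow> bool"
  where "C1_on f W \<longleftrightarrow>
    (\<exists>D :: 'a \<Rightarrow> 'a \<Rightarrow>\<^sub>L 'b.
      (\<forall>x\<in>W. (f has_derivative blinfun_apply (D x)) (at x)) \<and> continuous_on W D)"

definition weakly_tends_to :: "(nat \<Rightarrow> 'a::real_normed_vector) \<Rightarrow> 'a \<Rightarrow> bool"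
  where "weakly_tends_to x a \<longleftrightarrow> (\<forall>l :: 'a \<Rightarrow>\<^sub>L real. (\<lambda>k. l (x k)) \<longlonglongrightarrow> l a)"

text \<open>
  Flattening charts take values in the ambient space, with a closed linear subspace as the local
  model. Closed subspaces of a Hilbert space are complemented, so no splitting condition is
  needed there. The dimension may differ between components.
\<close>

definition C1_submanifold :: "'a::{real_inner,banach} set \<Rightarrow> bool"
  where "C1_submanifold M \<longleftrightarrow>
    (\<forall>p\<in>M. \<exists>W W' \<phi> \<psi> (L :: 'a set).
      open W \<and> p \<in> W \<and> open W' \<and>
      homeomorphism W W' \<phi> \<psi> \<and> C1_on \<phi> W \<and> C1_on \<psi> W' \<and>
      subspace L \<and> closed L \<and> \<phi> ` (W \<inter> M) = W' \<inter> L)"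

definition curve_at :: "'a::real_normed_vector set \<Rightarrow> 'a \<Rightarrow> 'a \<Rightarrow> (real \<Rightarrow> 'a) \<Rightarrow> bool"
  where "curve_at M p v \<gamma> \<longleftrightarrow>
    (\<exists>\<epsilon>>0. \<gamma> C1_differentiable_on {-\<epsilon><..<\<epsilon>} \<and> \<gamma> ` {-\<epsilon><..<\<epsilon>} \<subseteq> M) \<and>
    \<gamma> 0 = p \<and> (\<gamma> has_vector_derivative v) (at 0)"

definition tangent_space :: "'a::real_normed_vector set \<Rightarrow> 'a \<Rightarrow> 'a set"
  where "tangent_space M p = {v. \<exists>\<gamma>. curve_at M p v \<gamma>}"

text \<open>
  The differential at \<open>p\<close> of a function on \<open>M\<close>, as a map on \<open>tangent_space M p\<close>. It depends only
  on the values of \<open>f\<close> on \<open>M\<close>, so \<open>f\<close> stands for its restriction to \<open>M\<close>. It is meaningful for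
  \<open>f\<close> that is \<open>C\<^sup>1\<close> on \<open>M\<close>; see \<open>differential_on_eq\<close> for restrictions of differentiable functions.
\<close>

definition differential_on :: "'a::real_normed_vector set \<Rightarrow> ('a \<Rightarrow> real) \<Rightarrow> 'a \<Rightarrow> 'a \<Rightarrow> real"
  where "differential_on M f p v =
    (THE d. \<forall>\<gamma>. curve_at M p v \<gamma> \<longrightarrow> ((f \<circ> \<gamma>) has_real_derivative d) (at 0))"

lemma differential_on_eq:
  assumes f: "(f has_derivative D) (at p)" and v: "v \<in> tangent_space M p"
  shows "differential_on M f p v = D v"
proof -
  have D: "((f \<circ> \<gamma>) has_real_derivative D v) (at 0)" if "curve_at M p v \<gamma>" for \<gamma>
  proof -
    have g: "(\<gamma> has_derivative (\<lambda>t. t *\<^sub>R v)) (at 0)" "\<gamma> 0 = p"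
      using that by (auto simp: curve_at_def has_vector_derivative_def)
    have "((f \<circ> \<gamma>) has_derivative (D \<circ> (\<lambda>t. t *\<^sub>R v))) (at 0)"
      using g f by (intro diff_chain_at) auto
    moreover have "D \<circ> (\<lambda>t. t *\<^sub>R v) = (*) (D v)"
      using has_derivative_linear[OF f] by (auto simp: linear_cmul fun_eq_iff)
    ultimately show ?thesis by (simp add: has_field_derivative_def)
  qed
  obtain \<gamma> where "curve_at M p v \<gamma>" using v by (auto simp: tangent_space_def)
  with D show ?thesis
    unfolding differential_on_def by (intro the_equality) (auto intro: DERIV_unique)
qed

definition dual_norm_on :: "'a::real_normed_vector set \<Rightarrow> ('a \<Rightarrow> real) \<Rightarrow> real"
  where "dual_norm_on T l = (SUP v\<in>{v\<in>T. norm v \<le> 1}. \<bar>l v\<bar>)"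

definition palais_smale_seq ::
    "'a::real_normed_vector set \<Rightarrow> ('a \<Rightarrow> real) \<Rightarrow> (nat \<Rightarrow> 'a) \<Rightarrow> bool"
  where "palais_smale_seq M f x \<longleftrightarrow>
    range x \<subseteq> M \<and> bdd_above (range (\<lambda>k. f (x k))) \<and>
    (\<lambda>k. dual_norm_on (tangent_space M (x k)) (differential_on M f (x k))) \<longlonglongrightarrow> 0"

definition palais_smale :: "'a::real_normed_vector set \<Rightarrow> ('a \<Rightarrow> real) \<Rightarrow> bool"
  where "palais_smale M f \<longleftrightarrow>
    (\<forall>x. palais_smale_seq M f x \<longrightarrow>
      (\<exists>r a. strict_mono (r :: nat \<Rightarrow> nat) \<and> a \<in> M \<and> (x \<circ> r) \<longlonglongrightarrow> a))"

definition controlled :: "'a::real_normed_vector set \<Rightarrow> ('a \<Rightarrow> real) \<Rightarrow> 'a set \<Rightarrow> bool"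
  where "controlled M E V \<longleftrightarrow> V \<subseteq> M \<and> bounded V \<and> bounded (E ` V)"

definition bounded_on_controlled ::
    "'a::real_normed_vector set \<Rightarrow> ('a \<Rightarrow> real) \<Rightarrow> ('a \<Rightarrow> 'b::real_normed_vector) \<Rightarrow> bool"
  where "bounded_on_controlled M E g \<longleftrightarrow> (\<forall>V. controlled M E V \<longrightarrow> bounded (g ` V))"

end

theory Submission
  imports Defs "HOL-Library.Diagonal_Subsequence"
begin

text \<open>
  Let \<open>x\<close> be a Palais--Smale sequence. Both energies are bounded below, so an upper bound on their
  sum bounds each of them along \<open>x\<close>; by (B*) the range of \<open>x\<close> is controlled. A subsequence \<open>y\<close>
  converges weakly (\<open>bounded_seq_weakly_convergent_subseq\<close>), its limit \<open>a\<close> lies in \<open>M\<close> by (L*), and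
  the compact embeddings turn weak into strong convergence in \<open>'b\<close> and \<open>'c\<close>
  (\<open>compact_embedding_weakly_tends_to\<close>).

  To see that \<open>y\<close> converges to \<open>a\<close> in norm, test the differential of \<open>E\<close> at \<open>y\<^sub>k\<close> with
  \<open>h\<^sub>k = y\<^sub>k - a\<close>. This vector need not be tangent to \<open>M\<close>, but it splits as
  \<open>pr h\<^sub>k + (h\<^sub>k - pr h\<^sub>k)\<close>:

    \<^item> on the tangential part, the differential of \<open>E\<close> is that of the total energy, which tends to
      zero in the dual norm while \<open>pr h\<^sub>k\<close> stays bounded, minus that of \<open>\<theta> F \<circ> \<iota>C\<close>; by (P*) the
      latter only sees \<open>Pr (\<iota>C h\<^sub>k)\<close>, which tends to zero;
    \<^item> on the complementary part, (D) gives \<open>S (\<iota>B h\<^sub>k)\<close>, which tends to zero.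

  Hence \<open>DE h\<^sub>k\<close> tends to zero. In the splitting (S) the lower order term \<open>R (\<iota>B h\<^sub>k)\<close> tends to zero as
  well, and \<open>\<mu>\<close> is bounded away from zero, so \<open>Q y\<^sub>k h\<^sub>k\<close> tends to zero. Weak convergence
  removes the part \<open>Q a h\<^sub>k\<close>, and coercivity of \<open>Q\<close> finishes the proof (\<open>coercive_weak_to_strong\<close>).

  The Hilbert space facts rest on one principle, \<open>nested_closed_convex_Inter_nonempty\<close>. It yields
  elements of least norm, hence Riesz representation, and it yields for every bounded sequence a
  point that lies in all closed convex sets containing a tail of the sequence. Such a tail point
  supplies the weak limit, and it identifies strong limits of the images of the sequence
  under a bounded linear map.
\<close>

section \<open>Closed convex sets in a Hilbert space\<close>

text \<open>
  Choose in each set a point of nearly least norm. The least norms increase to a limit, and the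
  midpoint of two chosen points still lies in an earlier set, so the parallelogram law makes the
  points a Cauchy sequence.
\<close>

lemma nested_closed_convex_Inter_nonempty:
  fixes C :: "nat \<Rightarrow> 'h::{real_inner,banach} set"
  assumes closed: "\<And>n. closed (C n)" and convex: "\<And>n. convex (C n)"
    and ne: "\<And>n. C n \<noteq> {}" and dec: "decseq C" and bdd: "bounded (C 0)"
  shows "(\<Inter>n. C n) \<noteq> {}"
proof -
  define d where "d n = infdist 0 (C n)" for n
  have d_le: "d n \<le> norm p" if "p \<in> C n" for n p
    using infdist_le[OF that, of 0] by (simp add: d_def dist_norm)
  have d_nonneg: "0 \<le> d n" for n
    by (simp add: d_def infdist_nonneg)
  have "\<exists>p\<in>C n. norm p < d n + 1 / real (Suc n)" for n
  proof (rule ccontr)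
    assume "\<not> ?thesis"
    then have "d n + 1 / real (Suc n) \<le> dist 0 p" if "p \<in> C n" for p
      using that by (force simp: dist_norm)
    then have "d n + 1 / real (Suc n) \<le> d n"
      unfolding d_def infdist_notempty[OF ne] by (intro cINF_greatest ne) auto
    then show False by (simp add: field_simps)
  qed
  then obtain p where p: "\<And>n. p n \<in> C n" "\<And>n. norm (p n) < d n + 1 / real (Suc n)"
    by metis
  obtain B where B: "\<And>q. q \<in> C 0 \<Longrightarrow> norm q \<le> B"
    using bdd by (auto simp: bounded_iff)
  have sub: "C n \<subseteq> C m" if "m \<le> n" for m n
    using dec that by (auto simp: decseq_def)
  have "incseq d"
    unfolding incseq_def d_def using infdist_mono[OF sub ne] by blast
  moreover have "d n \<le> B" for n
    using d_le[OF p(1)[of n]] B[of "p n"] p(1)[of n] sub[of 0 n] by force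
  ultimately obtain D where D: "d \<longlonglongrightarrow> D"
    using incseq_convergent by blast
  have "(\<lambda>n. norm (p n)) \<longlonglongrightarrow> D"
  proof (rule tendsto_sandwich[OF _ _ D])
    show "\<forall>\<^sub>F n in sequentially. d n \<le> norm (p n)"
      using d_le p(1) by simp
    show "\<forall>\<^sub>F n in sequentially. norm (p n) \<le> d n + 1 / real (Suc n)"
      using p(2) by (simp add: less_imp_le)
    show "(\<lambda>n. d n + 1 / real (Suc n)) \<longlonglongrightarrow> D"
      using tendsto_add[OF D LIMSEQ_inverse_real_of_nat] by (simp add: inverse_eq_divide)
  qed
  then have lims: "(\<lambda>n. (norm (p n))\<^sup>2) \<longlonglongrightarrow> D\<^sup>2" "(\<lambda>n. (d n)\<^sup>2) \<longlonglongrightarrow> D\<^sup>2"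
    using D by (auto intro: tendsto_power)
  have "Cauchy p"
  proof (rule CauchyI)
    fix e :: real assume "0 < e"
    \<comment> \<open>The parallelogram law below leaves a total error of \<open>8 * \<delta>\<close>.\<close>
    define \<delta> where "\<delta> = e\<^sup>2 / 8"
    have \<delta>: "0 < \<delta>" using \<open>0 < e\<close> by (simp add: \<delta>_def)
    have "\<forall>\<^sub>F n in sequentially. (norm (p n))\<^sup>2 < D\<^sup>2 + \<delta> \<and> D\<^sup>2 - \<delta> < (d n)\<^sup>2"
      using order_tendstoD(2)[OF lims(1), of "D\<^sup>2 + \<delta>"] order_tendstoD(1)[OF lims(2), of "D\<^sup>2 - \<delta>"] \<delta>
      by (auto intro: eventually_conj)
    then obtain N where N: "\<And>n. n \<ge> N \<Longrightarrow> (norm (p n))\<^sup>2 < D\<^sup>2 + \<delta> \<and> D\<^sup>2 - \<delta> < (d n)\<^sup>2"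
      by (auto simp: eventually_sequentially)
    have "norm (p m - p n) < e" if "m \<ge> N" "n \<ge> N" for m n
    proof -
      have "p m \<in> C N" "p n \<in> C N" using p(1) sub that by blast+
      then have "(1/2) *\<^sub>R p m + (1/2) *\<^sub>R p n \<in> C N"
        using convex by (intro convexD) auto
      then have "d N \<le> norm ((1/2) *\<^sub>R (p m + p n))"
        using d_le by (simp add: scaleR_add_right)
      then have "(2 * d N)\<^sup>2 \<le> (norm (p m + p n))\<^sup>2"
        using d_nonneg by (intro power_mono) auto
      moreover have "(norm (p m - p n))\<^sup>2 = 2 * (norm (p m))\<^sup>2 + 2 * (norm (p n))\<^sup>2 - (norm (p m + p n))\<^sup>2"
        by (simp add: power2_norm_eq_inner inner_add inner_diff inner_commute)
      moreover have "8 * \<delta> = e\<^sup>2" by (simp add: \<delta>_def)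
      ultimately have "(norm (p m - p n))\<^sup>2 < e\<^sup>2"
        using N[OF that(1)] N[OF that(2)] N[of N] by (simp add: power_mult_distrib)
      then show ?thesis
        by (rule power2_less_imp_less) (use \<open>0 < e\<close> in simp)
    qed
    then show "\<exists>N. \<forall>m\<ge>N. \<forall>n\<ge>N. norm (p m - p n) < e" by blast
  qed
  then obtain q where q: "p \<longlonglongrightarrow> q"
    using Cauchy_convergent convergentD by blast
  have "q \<in> C n" for n
  proof (rule Lim_in_closed_set[OF closed _ sequentially_bot q])
    show "\<forall>\<^sub>F k in sequentially. p k \<in> C n"
      unfolding eventually_sequentially using p(1) sub by blast
  qed
  then show ?thesis by blast
qed

text \<open>
  Cutting the set with balls whose radii decrease to its distance from the origin gives a nested
  sequence; any common point has least norm.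
\<close>

lemma closed_convex_min_norm:
  fixes C :: "'h::{real_inner,banach} set"
  assumes "closed C" "convex C" "C \<noteq> {}"
  obtains p where "p \<in> C" "\<And>q. q \<in> C \<Longrightarrow> norm p \<le> norm q"
proof -
  define d where "d = infdist 0 C"
  define K where "K n = C \<inter> cball 0 (d + 1 / real (Suc n))" for n
  have "(\<Inter>n. K n) \<noteq> {}"
  proof (rule nested_closed_convex_Inter_nonempty)
    show "K n \<noteq> {}" for n
    proof
      assume "K n = {}"
      then have "d + 1 / real (Suc n) \<le> dist 0 p" if "p \<in> C" for p
        using that by (force simp: K_def)
      then have "d + 1 / real (Suc n) \<le> d"
        unfolding d_def infdist_notempty[OF assms(3)] by (intro cINF_greatest assms) auto
      then show False by (simp add: field_simps)
    qed
    have "1 / real (Suc n) \<le> 1 / real (Suc m)" if "m \<le> n" for m n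
      using that by (simp add: frac_le)
    then show "decseq K"
      unfolding decseq_def K_def by (fastforce intro: order_trans)
  qed (auto simp: K_def assms intro!: closed_Int convex_Int bounded_Int)
  then obtain p where p: "\<And>n. p \<in> K n" by blast
  have "(\<lambda>n. d + 1 / real (Suc n)) \<longlonglongrightarrow> d + 0"
    using tendsto_add[OF tendsto_const LIMSEQ_inverse_real_of_nat] by (simp add: inverse_eq_divide)
  then have "norm p \<le> d"
    using p by (intro LIMSEQ_le_const[of _ d]) (auto simp: K_def)
  moreover have "d \<le> norm q" if "q \<in> C" for q
    using infdist_le[OF that, of 0] by (simp add: d_def)
  ultimately show ?thesis using that p by (force simp: K_def)
qed

text \<open>
  An element \<open>p\<close> of least norm in the affine slice \<open>l = 1\<close> of \<open>Y\<close> is orthogonal to the kernel of \<open>l\<close> in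
  \<open>Y\<close>, so \<open>l\<close> is a multiple of the inner product with \<open>p\<close>. The proof of weak compactness relies on
  the representing element lying in \<open>Y\<close> itself.
\<close>

lemma riesz_on_closed_subspace:
  fixes l :: "'h::{real_inner,banach} \<Rightarrow> real"
  assumes l: "bounded_linear l" and Y: "subspace Y" "closed Y"
  obtains z where "z \<in> Y" "\<And>y. y \<in> Y \<Longrightarrow> l y = z \<bullet> y"
proof (cases "\<exists>y\<in>Y. l y \<noteq> 0")
  case False
  then show ?thesis using that[of 0] subspace_0[OF Y(1)] by simp
next
  case True
  interpret bounded_linear l by fact
  from True obtain y0 where y0: "y0 \<in> Y" "l y0 \<noteq> 0" by blast
  define C where "C = Y \<inter> l -` {1}"
  have "closed (l -` {1})"
    by (intro closed_vimage linear_continuous_on l) simp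
  then have "closed C" unfolding C_def using Y by blast
  moreover have "convex C"
    unfolding C_def
    by (intro convex_Int subspace_imp_convex[OF Y(1)] convex_linear_vimage linear_axioms convex_singleton)
  moreover have "(1 / l y0) *\<^sub>R y0 \<in> C"
    using y0 Y by (auto simp: C_def scaleR subspace_scale)
  ultimately obtain p where p: "p \<in> C" and min: "\<And>q. q \<in> C \<Longrightarrow> norm p \<le> norm q"
    using closed_convex_min_norm by blast
  have pY: "p \<in> Y" and lp: "l p = 1" using p by (auto simp: C_def)
  have orth: "p \<bullet> w = 0" if w: "w \<in> Y" "l w = 0" for w
  proof (rule ccontr)
    assume nz: "p \<bullet> w \<noteq> 0"
    then have ww: "0 < w \<bullet> w" by auto
    \<comment> \<open>The \<open>t\<close> that minimises \<open>norm (p + t *\<^sub>R w)\<close>.\<close>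
    define t where "t = - (p \<bullet> w) / (w \<bullet> w)"
    have "p + t *\<^sub>R w \<in> C"
      using pY lp w Y by (auto simp: C_def add scaleR intro: subspace_add subspace_scale)
    then have "(norm p)\<^sup>2 \<le> (norm (p + t *\<^sub>R w))\<^sup>2"
      using min by (intro power_mono) auto
    also have "\<dots> = (norm p)\<^sup>2 + 2 * t * (p \<bullet> w) + t\<^sup>2 * (w \<bullet> w)"
      by (simp add: power2_norm_eq_inner inner_add inner_commute)
         (simp add: power2_eq_square)
    also have "\<dots> = (norm p)\<^sup>2 - (p \<bullet> w)\<^sup>2 / (w \<bullet> w)"
      using ww by (simp add: t_def power2_eq_square field_simps)
    finally show False using nz ww by (simp add: divide_le_0_iff not_less)
  qed
  have pp: "0 < p \<bullet> p" using lp zero by auto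
  show ?thesis
  proof (rule that)
    show "(1 / (p \<bullet> p)) *\<^sub>R p \<in> Y" using pY Y by (simp add: subspace_scale)
    fix y assume "y \<in> Y"
    then have "p \<bullet> (y - l y *\<^sub>R p) = 0"
      using pY lp Y by (intro orth) (auto simp: diff scaleR intro: subspace_diff subspace_scale)
    then show "l y = (1 / (p \<bullet> p)) *\<^sub>R p \<bullet> y"
      using pp by (simp add: inner_simps field_simps)
  qed
qed

section \<open>Weak sequential compactness\<close>

text \<open>
  The closed convex hulls of the tails of the sequence are nested.
\<close>

lemma bounded_seq_tail_point:
  fixes x :: "nat \<Rightarrow> 'h::{real_inner,banach}"
  assumes "bounded (range x)"
  obtains a where "\<And>K. closed K \<Longrightarrow> convex K \<Longrightarrow> \<forall>\<^sub>F k in sequentially. x k \<in> K \<Longrightarrow> a \<in> K"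
proof -
  define C where "C n = closure (convex hull (x ` {n..}))" for n
  have "(\<Inter>n. C n) \<noteq> {}"
  proof (rule nested_closed_convex_Inter_nonempty)
    show "decseq C"
      unfolding decseq_def C_def by (auto intro!: closure_mono hull_mono image_mono)
    show "bounded (C 0)"
      using assms by (simp add: C_def bounded_convex_hull bounded_closure atLeast_0)
  qed (auto simp: C_def convex_closure)
  then obtain a where a: "\<And>n. a \<in> C n" by blast
  have "a \<in> K" if K: "closed K" "convex K" and ev: "\<forall>\<^sub>F k in sequentially. x k \<in> K" for K
  proof -
    obtain n where "x ` {n..} \<subseteq> K"
      using ev by (auto simp: eventually_sequentially)
    then have "C n \<subseteq> K"
      unfolding C_def using K by (intro closure_minimal hull_minimal)
    then show ?thesis using a by blast
  qed
  then show ?thesis using that by blast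
qed

text \<open>
  The preimage under \<open>T\<close> of a ball around the limit is closed and convex and contains a tail of the
  sequence.
\<close>

lemma tail_point_image:
  fixes x :: "nat \<Rightarrow> 'a::real_normed_vector" and T :: "'a \<Rightarrow> 'b::real_normed_vector"
  assumes a: "\<And>K. closed K \<Longrightarrow> convex K \<Longrightarrow> \<forall>\<^sub>F k in sequentially. x k \<in> K \<Longrightarrow> a \<in> K"
    and T: "bounded_linear T" and lim: "(\<lambda>k. T (x k)) \<longlonglongrightarrow> z"
  shows "T a = z"
proof -
  have "dist z (T a) \<le> e" if "0 < e" for e
  proof -
    have "a \<in> T -` cball z e"
    proof (rule a)
      show "closed (T -` cball z e)"
        by (intro closed_vimage linear_continuous_on T) auto
      show "convex (T -` cball z e)"
        by (intro convex_linear_vimage bounded_linear.linear T) auto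
      show "\<forall>\<^sub>F k in sequentially. x k \<in> T -` cball z e"
        using tendstoD[OF lim that] by eventually_elim (simp add: dist_commute)
    qed
    then show ?thesis by simp
  qed
  then have "dist z (T a) \<le> 0" by (rule field_le_epsilon[of _ 0, simplified])
  then show ?thesis by simp
qed

lemma weakly_tends_toD:
  assumes "weakly_tends_to x a" "bounded_linear l"
  shows "(\<lambda>k. l (x k)) \<longlonglongrightarrow> (l a :: real)"
  using assms unfolding weakly_tends_to_def by (metis bounded_linear_Blinfun_apply)

text \<open>
  The functionals given by a bounded sequence are equicontinuous, so convergence at approximating
  vectors gives the Cauchy property at their limit.
\<close>

lemma closed_inner_convergent:
  fixes x :: "nat \<Rightarrow> 'h::real_inner"
  assumes "bounded (range x)"
  shows "closed {y. convergent (\<lambda>k. x k \<bullet> y)}"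
proof -
  obtain B where B: "0 < B" "\<And>k. norm (x k) \<le> B"
    using assms by (auto simp: bounded_pos)
  have "convergent (\<lambda>k. x k \<bullet> y)"
    if conv: "\<And>n. convergent (\<lambda>k. x k \<bullet> u n)" and u: "u \<longlonglongrightarrow> y" for u y
  proof -
    have "Cauchy (\<lambda>k. x k \<bullet> y)"
    proof (rule CauchyI)
      fix e :: real assume e: "0 < e"
      have "0 < e / (3 * B)" using e B by simp
      then obtain n where n: "norm (u n - y) < e / (3 * B)"
        using u unfolding LIMSEQ_iff by blast
      have "Cauchy (\<lambda>k. x k \<bullet> u n)"
        using conv convergent_Cauchy by blast
      then obtain N where N: "\<And>j k. j \<ge> N \<Longrightarrow> k \<ge> N \<Longrightarrow> norm (x j \<bullet> u n - x k \<bullet> u n) < e / 3"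
        using e by (meson CauchyD zero_less_divide_iff zero_less_numeral)
      have close: "\<bar>x k \<bullet> (u n - y)\<bar> < e / 3" for k
      proof -
        have "\<bar>x k \<bullet> (u n - y)\<bar> \<le> norm (x k) * norm (u n - y)"
          by (rule Cauchy_Schwarz_ineq2)
        also have "\<dots> \<le> B * norm (u n - y)" using B by (intro mult_right_mono) auto
        also have "\<dots> < e / 3" using n B by (simp add: field_simps)
        finally show ?thesis .
      qed
      have "norm (x j \<bullet> y - x k \<bullet> y) < e" if "j \<ge> N" "k \<ge> N" for j k
        using N[OF that] close[of j] close[of k] unfolding inner_diff_right real_norm_def by linarith
      then show "\<exists>N. \<forall>j\<ge>N. \<forall>k\<ge>N. norm (x j \<bullet> y - x k \<bullet> y) < e" by blast
    qed
    then show ?thesis by (rule Cauchy_convergent)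
  qed
  then show ?thesis unfolding closed_sequential_limits by blast
qed

text \<open>
  A diagonal argument over the countably many vectors \<open>x j\<close>, each of which only asks a bounded
  sequence of reals to converge along a subsequence.
\<close>

lemma inner_convergent_subseq:
  fixes x :: "nat \<Rightarrow> 'h::real_inner"
  assumes "bounded (range x)"
  obtains r where "strict_mono r" "\<And>j. convergent (\<lambda>k. x (r k) \<bullet> x j)"
proof -
  obtain B where B: "\<And>k. norm (x k) \<le> B"
    using assms by (auto simp: bounded_iff)
  interpret subseqs "\<lambda>j r. convergent (\<lambda>k. x (r k) \<bullet> x j)"
  proof
    fix j and s :: "nat \<Rightarrow> nat"
    have "bounded (range (\<lambda>k. x (s k) \<bullet> x j))"
      unfolding bounded_iff
    proof (intro exI ballI, clarsimp)
      show "\<bar>x (s k) \<bullet> x j\<bar> \<le> B * norm (x j)" for k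
        using Cauchy_Schwarz_ineq2[of "x (s k)" "x j"] mult_right_mono[OF B[of "s k"], of "norm (x j)"] by simp
    qed
    then show "\<exists>r'. strict_mono r' \<and> convergent (\<lambda>k. x ((s \<circ> r') k) \<bullet> x j)"
      using bounded_imp_convergent_subsequence by (fastforce simp: convergent_def o_def)
  qed
  show ?thesis
  proof (rule that[OF subseq_diagseq])
    fix j
    have "convergent (\<lambda>k. x ((diagseq \<circ> (+) (Suc j)) k) \<bullet> x j)"
      by (rule diagseq_holds) (auto simp: o_def dest: convergent_subseq_convergent)
    then have "convergent (\<lambda>k. x (diagseq (k + Suc j)) \<bullet> x j)"
      by (simp add: add.commute)
    then show "convergent (\<lambda>k. x (diagseq k) \<bullet> x j)"
      using convergent_ignore_initial_segment[of "\<lambda>k. x (diagseq k) \<bullet> x j" "Suc j"] by blast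
  qed
qed

text \<open>
  Along the subsequence of \<open>inner_convergent_subseq\<close>, the vectors whose inner products with it converge form a closed
  subspace that contains the sequence. A functional \<open>l\<close> is represented on this subspace by one of its
  elements, so \<open>l\<close> converges along the subsequence; the limit must be the value of \<open>l\<close> at a tail
  point.
\<close>

theorem bounded_seq_weakly_convergent_subseq:
  fixes x :: "nat \<Rightarrow> 'h::{real_inner,banach}"
  assumes "bounded (range x)"
  obtains r a where "strict_mono r" "weakly_tends_to (x \<circ> r) a"
proof -
  obtain r where r: "strict_mono r" and conv: "\<And>j. convergent (\<lambda>k. x (r k) \<bullet> x j)"
    using inner_convergent_subseq[OF assms] by blast
  have bdd: "bounded (range (\<lambda>k. x (r k)))"
    using assms by (rule bounded_subset) auto
  obtain a where a: "\<And>K. closed K \<Longrightarrow> convex K \<Longrightarrow> \<forall>\<^sub>F k in sequentially. x (r k) \<in> K \<Longrightarrow> a \<in> K"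
    using bounded_seq_tail_point[OF bdd] by blast
  define Y where "Y = {y. convergent (\<lambda>k. x (r k) \<bullet> y)}"
  have Y: "subspace Y" "closed Y"
    unfolding Y_def using closed_inner_convergent[OF bdd]
    by (auto simp: subspace_def inner_add_right convergent_const
        intro: convergent_add convergent_mult)
  have "(\<lambda>k. l (x (r k))) \<longlonglongrightarrow> l a" if l: "bounded_linear l" for l :: "'h \<Rightarrow> real"
  proof -
    obtain z where z: "z \<in> Y" "\<And>y. y \<in> Y \<Longrightarrow> l y = z \<bullet> y"
      using riesz_on_closed_subspace[OF l Y] by blast
    have "l (x (r k)) = x (r k) \<bullet> z" for k
      using z(2)[of "x (r k)"] conv by (simp add: Y_def inner_commute)
    then have "convergent (\<lambda>k. l (x (r k)))"
      using z(1) by (simp add: Y_def)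
    then obtain L where "(\<lambda>k. l (x (r k))) \<longlonglongrightarrow> L"
      by (auto simp: convergent_def)
    with tail_point_image[OF a l this] show ?thesis by simp
  qed
  then have "weakly_tends_to (x \<circ> r) a"
    by (auto simp: weakly_tends_to_def blinfun.bounded_linear_right)
  with r show ?thesis using that by blast
qed

text \<open>
  Otherwise some subsequence of the images stays away from \<open>\<iota> a\<close> and yet, by compactness, converges
  to some \<open>z\<close>. A tail point \<open>b\<close> of this subsequence satisfies \<open>\<iota> b = z\<close>, and weak convergence
  forces \<open>b = a\<close>.
\<close>

lemma compact_embedding_weakly_tends_to:
  fixes \<iota> :: "'h::{real_inner,banach} \<Rightarrow> 'b::real_normed_vector"
  assumes \<iota>: "compact_embedding \<iota>" and bdd: "bounded (range x)" and weak: "weakly_tends_to x a"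
  shows "(\<lambda>k. \<iota> (x k)) \<longlonglongrightarrow> \<iota> a"
proof (rule ccontr)
  have lin: "bounded_linear \<iota>"
    using \<iota> by (simp add: compact_embedding_def)
  have cpt: "compact (closure (\<iota> ` range x))"
    using \<iota> bdd by (simp only: compact_embedding_def)
  assume "\<not> ?thesis"
  then obtain e where e: "0 < e" "\<And>N. \<exists>k\<ge>N. e \<le> dist (\<iota> (x k)) (\<iota> a)"
    unfolding lim_sequentially by (auto simp: not_less)
  then have "infinite {k. e \<le> dist (\<iota> (x k)) (\<iota> a)}"
    by (simp add: infinite_nat_iff_unbounded_le)
  then obtain s :: "nat \<Rightarrow> nat" where s: "strict_mono s" "\<And>k. e \<le> dist (\<iota> (x (s k))) (\<iota> a)"
    using infinite_enumerate by (metis (mono_tags, lifting) mem_Collect_eq)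
  have "\<iota> (x (s k)) \<in> closure (\<iota> ` range x)" for k
    by (meson closure_subset image_eqI rangeI subsetD)
  then obtain t z where "strict_mono t" "((\<lambda>k. \<iota> (x (s k))) \<circ> t) \<longlonglongrightarrow> z"
    using cpt[unfolded compact_def, rule_format, of "\<lambda>k. \<iota> (x (s k))"] by blast
  then have t: "strict_mono t" "(\<lambda>k. \<iota> (x (s (t k)))) \<longlonglongrightarrow> z"
    by (simp_all add: o_def)
  have "bounded (range (\<lambda>k. x (s (t k))))"
    using bdd by (rule bounded_subset) auto
  then obtain b where b:
    "\<And>K. closed K \<Longrightarrow> convex K \<Longrightarrow> \<forall>\<^sub>F k in sequentially. x (s (t k)) \<in> K \<Longrightarrow> b \<in> K"
    using bounded_seq_tail_point by blast
  \<comment> \<open>Testing with the inner product with \<open>a - b\<close> shows \<open>b = a\<close>.\<close>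
  have "(\<lambda>k. (a - b) \<bullet> x (s (t k))) \<longlonglongrightarrow> (a - b) \<bullet> a"
    using LIMSEQ_subseq_LIMSEQ[OF weakly_tends_toD[OF weak bounded_linear_inner_right]
        strict_mono_o[OF s(1) t(1)]] by (simp add: o_def)
  from tail_point_image[OF b bounded_linear_inner_right this]
  have "(a - b) \<bullet> (a - b) = 0" by (simp add: inner_diff_right)
  then have "\<iota> a = z"
    using tail_point_image[OF b lin t(2)] by simp
  with t(2) have "\<forall>\<^sub>F k in sequentially. dist (\<iota> (x (s (t k)))) (\<iota> a) < e"
    using e(1) by (auto dest: tendstoD)
  with s(2) show False by (auto simp: eventually_sequentially not_less[symmetric])
qed

section \<open>Dual norms\<close>

text \<open>
  The usual normalisation \<open>v / norm v\<close>. Boundedness of \<open>D\<close> ensures that the supremum in the dual norm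
  is a genuine one rather than an unspecified value. Closure of \<open>T\<close> under scaling is assumed directly
  because for tangent spaces it is read off from their being ranges of projectors.
\<close>

lemma dual_norm_on_bound:
  fixes T :: "'a::real_normed_vector set"
  assumes lin: "bounded_linear D" and eq: "\<And>v. v \<in> T \<Longrightarrow> l v = D v"
    and scale: "\<And>t v. v \<in> T \<Longrightarrow> t *\<^sub>R v \<in> T" and v: "v \<in> T"
  shows "\<bar>l v\<bar> \<le> dual_norm_on T l * norm v"
proof (cases "v = 0")
  case True
  then show ?thesis using eq[OF v] linear_0[OF bounded_linear.linear[OF lin]] by simp
next
  case False
  obtain K where K: "\<And>u. norm (D u) \<le> norm u * K" "0 < K"
    using bounded_linear.pos_bounded[OF lin] by blast
  define w where "w = (1 / norm v) *\<^sub>R v"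
  have w: "w \<in> T" "norm w \<le> 1"
    using v scale False by (auto simp: w_def)
  have "\<bar>l u\<bar> \<le> K" if "u \<in> T" "norm u \<le> 1" for u
    using order_trans[OF K(1)[of u] mult_right_mono[OF that(2), of K]] K(2) eq that(1) by simp
  then have "\<bar>l w\<bar> \<le> dual_norm_on T l"
    unfolding dual_norm_on_def using w by (intro cSUP_upper bdd_aboveI2[of _ _ K]) auto
  moreover have "\<bar>l v\<bar> = \<bar>l w\<bar> * norm v"
    using eq v w(1) False linear_scale[OF bounded_linear.linear[OF lin]]
    by (simp add: w_def abs_mult)
  ultimately show ?thesis by (simp add: mult_right_mono)
qed


section \<open>The Palais--Smale condition\<close>

lemma bounded_blinfun_tendsto_zero:
  fixes G :: "nat \<Rightarrow> 'a::real_normed_vector \<Rightarrow>\<^sub>L 'b::real_normed_vector"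
  assumes "bounded (range G)" "u \<longlonglongrightarrow> 0"
  shows "(\<lambda>k. G k (u k)) \<longlonglongrightarrow> 0"
proof -
  obtain B where B: "\<And>k. norm (G k) \<le> B"
    using assms(1) by (auto simp: bounded_iff)
  have "norm (G k (u k)) \<le> B * norm (u k)" for k
    using norm_blinfun[of "G k" "u k"] mult_right_mono[OF B[of k] norm_ge_zero[of "u k"]]
    by (rule order_trans)
  moreover have "(\<lambda>k. B * norm (u k)) \<longlonglongrightarrow> 0"
    using tendsto_mult_left[OF tendsto_norm_zero[OF assms(2)], of B] by simp
  ultimately show ?thesis
    by (auto intro: Lim_null_comparison[of _ "\<lambda>k. B * norm (u k)"])
qed

text \<open>
  \<open>Q a (y\<^sub>k - a)\<close> tends to zero by weak convergence, hence so does \<open>Q (y\<^sub>k - a) (y\<^sub>k - a)\<close>, which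
  dominates the squared norm.
\<close>

lemma coercive_weak_to_strong:
  fixes Q :: "'h::real_normed_vector \<Rightarrow> 'h \<Rightarrow> real"
  assumes Q: "bounded_bilinear Q" and c: "0 < c" "\<And>h. c * (norm h)\<^sup>2 \<le> Q h h"
    and weak: "weakly_tends_to y a" and lim: "(\<lambda>k. Q (y k) (y k - a)) \<longlonglongrightarrow> 0"
  shows "y \<longlonglongrightarrow> a"
proof -
  interpret bounded_bilinear Q by fact
  have "(\<lambda>k. Q a (y k)) \<longlonglongrightarrow> Q a a"
    by (rule weakly_tends_toD[OF weak bounded_linear_right])
  then have "(\<lambda>k. Q a (y k - a)) \<longlonglongrightarrow> 0"
    by (simp add: diff_right LIM_zero)
  from tendsto_diff[OF lim this] have lim0: "(\<lambda>k. Q (y k - a) (y k - a) / c) \<longlonglongrightarrow> 0"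
    by (auto simp: diff_left intro: tendsto_divide_zero)
  have "(\<lambda>k. (norm (y k - a))\<^sup>2) \<longlonglongrightarrow> 0"
  proof (rule tendsto_sandwich[OF _ _ tendsto_const lim0])
    show "\<forall>\<^sub>F k in sequentially. (norm (y k - a))\<^sup>2 \<le> Q (y k - a) (y k - a) / c"
      using c by (simp add: field_simps)
  qed simp
  then have "(\<lambda>k. sqrt ((norm (y k - a))\<^sup>2)) \<longlonglongrightarrow> sqrt 0"
    by (rule tendsto_real_sqrt)
  then show ?thesis
    by (simp add: LIM_zero_iff tendsto_norm_zero_iff)
qed

theorem corollary2p3:
  fixes \<iota>B :: "'h::{real_inner,banach} \<Rightarrow> 'b::banach"
    and \<iota>C :: "'h \<Rightarrow> 'c::banach"
    and \<Omega> M :: "'h set" and U :: "'c set"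
    and E :: "'h \<Rightarrow> real" and F :: "'c \<Rightarrow> real"
    and pr :: "'h \<Rightarrow> 'h \<Rightarrow>\<^sub>L 'h" and Pr :: "'h \<Rightarrow> 'c \<Rightarrow>\<^sub>L 'c"
    and \<mu> :: "'h \<Rightarrow> real" and Q :: "'h \<Rightarrow> 'h \<Rightarrow> real"
    and R S :: "'h \<Rightarrow> 'b \<Rightarrow>\<^sub>L real"
    and c \<theta> :: real
  assumes "compact_embedding \<iota>B" and "compact_embedding \<iota>C"
    and "open \<Omega>" and "open U" and "\<iota>C ` \<Omega> \<subseteq> U"
    and "C1_on E \<Omega>" and "C1_on F U"
    and "C1_submanifold M" and "M \<subseteq> \<Omega>"
    and "bdd_below (E ` M)" and "bdd_below ((F \<circ> \<iota>C) ` M)"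
    and pr_cont: "continuous_on M pr"
    and pr_proj: "\<And>x. x \<in> M \<Longrightarrow> pr x o\<^sub>L pr x = pr x \<and> range (pr x) = tangent_space M x"
    and P: "bounded_on_controlled M E pr"
    and Pstar: "bounded_on_controlled M E Pr"
      "\<And>x h. x \<in> M \<Longrightarrow> \<iota>C (pr x h) = Pr x (\<iota>C h)"
    and Bstar: "\<And>K. bounded {x \<in> M. E x \<le> K}"
    and Lstar: "\<And>x a. range x \<subseteq> M \<Longrightarrow> weakly_tends_to x a \<Longrightarrow>
      bdd_above (range (\<lambda>k. F (\<iota>C (x k)))) \<Longrightarrow> a \<in> M"
    and S: "\<And>x. x \<in> M \<Longrightarrow> 0 < \<mu> x" "bounded_bilinear Q"
      "\<And>x h. x \<in> M \<Longrightarrow> frechet_derivative E (at x) h = \<mu> x * Q x h + R x (\<iota>B h)"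
    and S1: "\<And>V. controlled M E V \<Longrightarrow> \<exists>m K. 0 < m \<and> m \<le> K \<and> (\<forall>x\<in>V. m \<le> \<mu> x \<and> \<mu> x \<le> K)"
    and S2: "0 < c" "\<And>h. c * (norm h)\<^sup>2 \<le> Q h h"
    and S3: "bounded_on_controlled M E R"
    and D: "bounded_on_controlled M E S"
      "\<And>x h. x \<in> M \<Longrightarrow> frechet_derivative E (at x) (h - pr x h) = S x (\<iota>B h)"
    and "0 < \<theta>"
  shows "palais_smale M (\<lambda>x. E x + \<theta> * F (\<iota>C x))"
proof -
  define T where "T = (\<lambda>x. E x + \<theta> * F (\<iota>C x))"
  have linB: "bounded_linear \<iota>B" and linC: "bounded_linear \<iota>C"
    using assms(1,2) by (auto simp: compact_embedding_def)
  obtain DE where DE: "\<And>x. x \<in> \<Omega> \<Longrightarrow> (E has_derivative blinfun_apply (DE x)) (at x)"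
    using \<open>C1_on E \<Omega>\<close> by (auto simp: C1_on_def)
  obtain DF where DF: "\<And>u. u \<in> U \<Longrightarrow> (F has_derivative blinfun_apply (DF u)) (at u)"
    and DF_cont: "continuous_on U DF"
    using \<open>C1_on F U\<close> by (auto simp: C1_on_def)
  have frE: "frechet_derivative E (at x) = DE x" if "x \<in> M" for x
    using frechet_derivative_at[OF DE, of x] that \<open>M \<subseteq> \<Omega>\<close> by auto
  have inU: "\<iota>C x \<in> U" if "x \<in> M" for x
    using that \<open>M \<subseteq> \<Omega>\<close> \<open>\<iota>C ` \<Omega> \<subseteq> U\<close> by blast
  define DT where "DT x h = DE x h + \<theta> * DF (\<iota>C x) (\<iota>C h)" for x h
  have DT: "(T has_derivative DT x) (at x)" if "x \<in> M" for x
  proof -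
    have "((\<lambda>x. F (\<iota>C x)) has_derivative (\<lambda>h. DF (\<iota>C x) (\<iota>C h))) (at x)"
      by (rule has_derivative_compose[OF bounded_linear_imp_has_derivative[OF linC] DF[OF inU[OF that]]])
    then show ?thesis
      unfolding T_def DT_def using DE that \<open>M \<subseteq> \<Omega>\<close>
      by (intro has_derivative_add has_derivative_mult_right) auto
  qed
  have DT_bound: "\<bar>DT x (pr x h)\<bar> \<le>
      dual_norm_on (tangent_space M x) (differential_on M T x) * norm (pr x h)"
    if x: "x \<in> M" for x h
  proof -
    have tan: "tangent_space M x = range (pr x)" using pr_proj[OF x] by simp
    have "t *\<^sub>R v \<in> tangent_space M x" if "v \<in> tangent_space M x" for t v
      using that unfolding tan by (auto simp: blinfun.scaleR_right[symmetric])
    then have "\<bar>differential_on M T x (pr x h)\<bar> \<le>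
        dual_norm_on (tangent_space M x) (differential_on M T x) * norm (pr x h)"
      using has_derivative_bounded_linear[OF DT[OF x]] differential_on_eq[OF DT[OF x]]
      by (intro dual_norm_on_bound) (auto simp: tan)
    moreover have "differential_on M T x (pr x h) = DT x (pr x h)"
      using differential_on_eq[OF DT[OF x]] tan by auto
    ultimately show ?thesis by simp
  qed
  show ?thesis
    unfolding palais_smale_def T_def[symmetric]
  proof (intro allI impI)
    fix x assume PS: "palais_smale_seq M T x"
    then have xM: "\<And>k. x k \<in> M" by (auto simp: palais_smale_seq_def)
    obtain KT where KT: "\<And>k. T (x k) \<le> KT"
      using PS by (auto simp: palais_smale_seq_def bdd_above_def)
    obtain mE where mE: "\<And>x. x \<in> M \<Longrightarrow> mE \<le> E x"
      using \<open>bdd_below (E ` M)\<close> by (auto simp: bdd_below_def)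
    obtain mF where mF: "\<And>x. x \<in> M \<Longrightarrow> mF \<le> F (\<iota>C x)"
      using \<open>bdd_below ((F \<circ> \<iota>C) ` M)\<close> by (auto simp: bdd_below_def)
    \<comment> \<open>An upper bound on the sum and lower bounds on both energies bound each energy.\<close>
    have E_le: "E (x k) \<le> KT - \<theta> * mF" for k
      using KT[of k] mult_left_mono[OF mF[OF xM[of k]], of \<theta>] \<open>0 < \<theta>\<close>
      unfolding T_def by linarith
    have F_le: "F (\<iota>C (x k)) \<le> (KT - mE) / \<theta>" for k
      using KT[of k] mE[OF xM[of k]] \<open>0 < \<theta>\<close> by (simp add: T_def field_simps)
    have bdd_x: "bounded (range x)"
      using Bstar[of "KT - \<theta> * mF"] by (rule bounded_subset) (use E_le xM in auto)
    have ctrl: "controlled M E (range x)"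
      unfolding controlled_def
    proof (intro conjI bdd_x)
      have "E ` range x \<subseteq> {mE..KT - \<theta> * mF}" using E_le mE xM by auto
      then show "bounded (E ` range x)" using bounded_closed_interval bounded_subset by blast
    qed (use xM in auto)
    obtain r a where r: "strict_mono r" and weak: "weakly_tends_to (x \<circ> r) a"
      using bounded_seq_weakly_convergent_subseq[OF bdd_x] by blast
    define y where "y = x \<circ> r"
    have yM: "y k \<in> M" for k using xM by (simp add: y_def)
    have sub: "range y \<subseteq> range x" by (auto simp: y_def)
    have bdd_y: "bounded (range y)" using bdd_x sub by (rule bounded_subset)
    have weak_y: "weakly_tends_to y a" using weak by (simp add: y_def)
    have "a \<in> M"
      using yM F_le by (intro Lstar[OF _ weak_y]) (auto simp: y_def bdd_above_def)
    define h where "h k = y k - a" for k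
    have hB: "(\<lambda>k. \<iota>B (h k)) \<longlonglongrightarrow> 0"
      using compact_embedding_weakly_tends_to[OF assms(1) bdd_y weak_y]
      by (simp add: h_def linear_diff[OF bounded_linear.linear[OF linB]] LIM_zero)
    have yC: "(\<lambda>k. \<iota>C (y k)) \<longlonglongrightarrow> \<iota>C a"
      by (rule compact_embedding_weakly_tends_to[OF assms(2) bdd_y weak_y])
    then have hC: "(\<lambda>k. \<iota>C (h k)) \<longlonglongrightarrow> 0"
      by (simp add: h_def linear_diff[OF bounded_linear.linear[OF linC]] LIM_zero)
    have bddc: "bounded (range (\<lambda>k. g (y k)))"
      if "bounded_on_controlled M E g" for g :: "'h \<Rightarrow> 'd::real_normed_vector"
    proof -
      have "bounded (g ` range x)" using that ctrl by (auto simp: bounded_on_controlled_def)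
      then show ?thesis by (rule bounded_subset) (auto simp: y_def)
    qed
    have bdd_prh: "bounded (range (\<lambda>k. pr (y k) (h k)))"
    proof -
      obtain B1 B2 where B: "\<And>k. norm (pr (y k)) \<le> B1" "\<And>k. norm (y k) \<le> B2"
        using bddc[OF P] bdd_y by (auto simp: bounded_iff)
      have "norm (pr (y k) (h k)) \<le> B1 * (B2 + norm a)" for k
      proof -
        have "norm (h k) \<le> B2 + norm a"
          using norm_triangle_ineq4[of "y k" a] B(2)[of k] by (simp add: h_def)
        with norm_blinfun[of "pr (y k)" "h k"] show ?thesis
          using mult_mono'[OF B(1)[of k], of "norm (h k)" "B2 + norm a"] by simp
      qed
      then show ?thesis by (auto simp: bounded_iff)
    qed
    have DTlim: "(\<lambda>k. DT (y k) (pr (y k) (h k))) \<longlonglongrightarrow> 0"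
    proof -
      define n where "n = (\<lambda>k. dual_norm_on (tangent_space M (x k)) (differential_on M T (x k)))"
      have "n \<longlonglongrightarrow> 0"
        using PS by (simp add: palais_smale_seq_def n_def)
      then have nr: "(\<lambda>k. n (r k)) \<longlonglongrightarrow> 0"
        using LIMSEQ_subseq_LIMSEQ[OF _ r, of n] by (simp only: comp_def)
      obtain B where B: "\<And>k. norm (pr (y k) (h k)) \<le> B"
        using bdd_prh unfolding bounded_iff by blast
      have "(\<lambda>k. n (r k) * norm (pr (y k) (h k))) \<longlonglongrightarrow> 0"
        by (rule lim_null_mult_right_bounded[OF nr, where B = B]) (simp add: B)
      moreover have "norm (DT (y k) (pr (y k) (h k))) \<le> n (r k) * norm (pr (y k) (h k))" for k
        using DT_bound[OF yM[of k], of "h k"] by (simp only: n_def y_def comp_def real_norm_def)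
      ultimately show ?thesis
        by (auto intro: Lim_null_comparison[of _ "\<lambda>k. n (r k) * norm (pr (y k) (h k))"])
    qed
    have DFlim: "(\<lambda>k. DF (\<iota>C (y k)) (\<iota>C (pr (y k) (h k)))) \<longlonglongrightarrow> 0"
    proof -
      \<comment> \<open>Here it matters that \<open>a \<in> M\<close>: the derivative of \<open>F\<close> is continuous at \<open>\<iota>C a\<close>.\<close>
      have "(\<lambda>k. DF (\<iota>C (y k))) \<longlonglongrightarrow> DF (\<iota>C a)"
        using continuous_on_tendsto_compose[OF DF_cont yC] inU[OF \<open>a \<in> M\<close>] inU[OF yM] by simp
      moreover have "(\<lambda>k. Pr (y k) (\<iota>C (h k))) \<longlonglongrightarrow> 0"
        by (rule bounded_blinfun_tendsto_zero[OF bddc[OF Pstar(1)] hC])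
      ultimately have "(\<lambda>k. DF (\<iota>C (y k)) (Pr (y k) (\<iota>C (h k)))) \<longlonglongrightarrow> DF (\<iota>C a) 0"
        by (rule blinfun.tendsto)
      then show ?thesis by (simp add: Pstar(2)[OF yM] blinfun.zero_right)
    qed
    have Slim: "(\<lambda>k. S (y k) (\<iota>B (h k))) \<longlonglongrightarrow> 0"
      by (rule bounded_blinfun_tendsto_zero[OF bddc[OF D(1)] hB])
    have Rlim: "(\<lambda>k. R (y k) (\<iota>B (h k))) \<longlonglongrightarrow> 0"
      by (rule bounded_blinfun_tendsto_zero[OF bddc[OF S3] hB])
    \<comment> \<open>The differential of \<open>E\<close> at \<open>y k\<close> along \<open>h k\<close>, once by (S) and once by splitting \<open>h k\<close> with the
      projector.\<close>
    have split: "\<mu> (y k) * Q (y k) (h k) =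
        DT (y k) (pr (y k) (h k)) - \<theta> * DF (\<iota>C (y k)) (\<iota>C (pr (y k) (h k)))
          + S (y k) (\<iota>B (h k)) - R (y k) (\<iota>B (h k))" for k
      using S(3)[OF yM[of k], of "h k"] D(2)[OF yM[of k], of "h k"]
      by (simp add: frE[OF yM] blinfun.diff_right DT_def)
    have "(\<lambda>k. \<mu> (y k) * Q (y k) (h k)) \<longlonglongrightarrow> 0 - \<theta> * 0 + 0 - 0"
      unfolding split by (intro tendsto_intros DTlim DFlim Slim Rlim)
    then have muQ: "(\<lambda>k. \<mu> (y k) * Q (y k) (h k)) \<longlonglongrightarrow> 0" by simp
    have "(\<lambda>k. Q (y k) (h k)) \<longlonglongrightarrow> 0"
    proof -
      obtain m where m: "0 < m" "\<And>k. m \<le> \<mu> (x k)"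
        using S1[OF ctrl] by blast
      have "\<bar>Q (y k) (h k)\<bar> \<le> \<bar>\<mu> (y k) * Q (y k) (h k)\<bar> / m" for k
        using mult_right_mono[OF m(2)[of "r k"], of "\<bar>Q (y k) (h k)\<bar>"] m(1) S(1)[OF yM[of k]]
        by (simp add: y_def abs_mult pos_le_divide_eq mult.commute)
      moreover have "(\<lambda>k. \<bar>\<mu> (y k) * Q (y k) (h k)\<bar> / m) \<longlonglongrightarrow> 0"
        using muQ by (intro tendsto_divide_zero tendsto_rabs_zero)
      ultimately show ?thesis
        by (auto intro: Lim_null_comparison[of _ "\<lambda>k. \<bar>\<mu> (y k) * Q (y k) (h k)\<bar> / m"])
    qed
    then have "y \<longlonglongrightarrow> a"
      unfolding h_def by (rule coercive_weak_to_strong[OF S(2) S2 weak_y])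
    then show "\<exists>r a. strict_mono (r :: nat \<Rightarrow> nat) \<and> a \<in> M \<and> (x \<circ> r) \<longlonglongrightarrow> a"
      using r \<open>a \<in> M\<close> unfolding y_def by blast
  qed
qed

end
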